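(* For every $N\ge1$, the mixed finite element (MFEM) approximation $\dot x_N=A_Nx_N+B_Nu(t)$, $x_N\in\mathbb{R}^{6N}$, $u(t)\in\mathbb{R}$, of the linear fully dynamic electromagnetic piezoelectric composite, with $A_N,B_N$ as defined in the context, satisfies Brockett's necessary condition for asymptotic stabilizability through continuous state feedback; that is, the image of the $6N\times(6N+1)$ matrix $\begin{bmatrix}A_N & B_N\end{bmatrix}$ is all of $\mathbb{R}^{6N}$.
   Context: Brockett's necessary condition for a system $\dot x=f(x,u)$, $x\in\mathbb{R}^n$, is that $f(x,u)=y$ is solvable for all $y$ with $\|y\|$ sufficiently small. For a linear system $\dot x=Ax+Bu$ this means $\operatorname{Image}\begin{bmatrix}A&B\end{bmatrix}=\mathbb{R}^n$. Physical constants. Subscripts $p$ and $s$ refer to the piezoelectric layer and to the substrate. $\rho_p,\rho_s>0$ are mass densities, $C_p=C_{11,p}>0$ and $C_s=C_{11,s}>0$ stiffnesses, $\beta,\mu>0$ electromagnetic constants, and $\gamma\in\mathbb{R}$ is the piezoelectric coupling constant. The piezoelectric layer has half-width $g_b>0$ and occupies heights $h_a<h_b$, and $$A_p=2g_b(h_b-h_a),\quad I_p=\tfrac23 g_b(h_b^3-h_a^3),\quad I_0=g_b(h_b^2-h_a^2).$$ $A_s,I_s>0$ are the cross-sectional area and the inertia of the substrate. Set $$\rho_A=\rho_pA_p+\rho_sA_s,\quad \rho_I=\rho_pI_p+\rho_sI_s,\quad \rho_{I_0}=\rho_pI_0,$$ $$C_A=C_pA_p+C_sA_s,\quad C_I=C_pI_p+C_sI_s,\quad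 C_{I_0}=C_{11,p}I_0,\quad \Delta=\rho_A\rho_I-\rho_{I_0}^2.$$ Underlying PDE (port-Hamiltonian form). The state is $x=(q_z,p)\in\mathbb{R}^3\times\mathbb{R}^3$ with $q_z=(v_z,w_{zz},\Phi_z)$ and $p$ the generalized momenta, and on $[0,\ell]$, $\ell>0$, $$\dot x=\begin{bmatrix} 0&I_3 \\ I_3&0 \end{bmatrix}\partial_z(Qx)+B^eu,\qquad B^e=(0,0,0,0,0,-(h_b-h_a))^T,$$ where $Q=\begin{bmatrix} Q_1&Q_2 \\ Q_2^T&Q_4 \end{bmatrix}$ with $$Q_1=\begin{bmatrix} C_A+\gamma^2\beta A_p&-(C_{I_0}+\gamma^2\beta I_0)&0 \\ -(C_{I_0}+\gamma^2\beta I_0)&C_I+\gamma^2\beta\frac{I_0^2}{A_p}&0 \\ 0&0&\frac{A_p}{\mu} \end{bmatrix},$$ $$Q_2=\begin{bmatrix} 0&0&-\gamma\beta \\ 0&0&\gamma\beta\frac{I_0}{A_p} \\ 0&0&0 \end{bmatrix},\qquad Q_4=\begin{bmatrix} \frac{\rho_I}{\Delta}&\frac{\rho_{I_0}}{\Delta}&0 \\ \frac{\rho_{I_0}}{\Delta}&\frac{\rho_A}{\Delta}&0 \\ 0&0&\frac{\beta}{A_p} \end{bmatrix}.$$ Boundary conditions: the last three components of $Qx$ (the flows $f$) vanish at $z=0$, and the first three components of $Qx$ (the efforts $e$) vanish at $z=\ell$. MFEM system. Let $0=z_0<z_1<\dots<z_N=\ell$. On $[a,b]=[z_{j-1},z_j]$,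 $x$ is approximated by $x_j(t)/(b-a)$ with $x_j=(q_j,p_j)\in\mathbb{R}^3\times\mathbb{R}^3$, while $Qx$ is approximated by the affine interpolant of its values at the endpoints. Write $f_j,e_j\in\mathbb{R}^3$ for the flow and effort values at the node $z_j$, $j=0,\dots,N$, shared by adjacent segments. Given $(x_1,\dots,x_N)$, these are determined uniquely by $$f_0=0,\qquad e_N=0,\qquad \begin{pmatrix} \frac12(e_{j-1}+e_j) \\ \frac12(f_{j-1}+f_j) \end{pmatrix}=\frac{1}{z_j-z_{j-1}}Qx_j\quad(j=1,\dots,N),$$ and the dynamics are $$\dot x_j=\begin{pmatrix} f_j-f_{j-1} \\ e_j-e_{j-1} \end{pmatrix}+B^eu(t),\qquad j=1,\dots,N.$$ Equivalently, on each segment $$\dot x_j=2\begin{bmatrix} 0&I_3 \\ -I_3&0 \end{bmatrix}\frac{1}{z_j-z_{j-1}}Qx_j+2\begin{pmatrix} -f_{j-1} \\ e_j \end{pmatrix}+B^eu.$$ Eliminating all $f_j,e_j$ gives the global linear system $\dot x_N=A_Nx_N+B_Nu$ with state $x_N=(x_1,\dots,x_N)\in\mathbb{R}^{6N}$ and $B_N=(B^e,\dots,B^e)^T\in\mathbb{R}^{6N}$. *)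

theory Defs
  imports Complex_Main "Jordan_Normal_Form.Matrix"
begin

text \<open>
  Vectors and matrices are those of \<^theory>\<open>Jordan_Normal_Form.Matrix\<close>, whose dimensions are
  ordinary natural numbers, so that the number of segments can be quantified over. Indices start
  at 0.
\<close>

section \<open>Brockett's condition\<close>

text \<open>
  The system is \<open>x' = f x u\<close> with state in \<open>\<real>\<^sup>n\<close> and control in \<open>\<real>\<^sup>m\<close>; the term
  \<open>sqrt (y \<bullet> y)\<close> is the Euclidean norm of \<open>y\<close>.
\<close>

definition brockett_condition ::
  "nat \<Rightarrow> nat \<Rightarrow> (real vec \<Rightarrow> real vec \<Rightarrow> real vec) \<Rightarrow> bool" where
  "brockett_condition n m f \<longleftrightarrow>
     (\<exists>\<delta>>0. \<forall>y\<in>carrier_vec n. sqrt (y \<bullet> y) < \<delta> \<longrightarrow>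
        (\<exists>x\<in>carrier_vec n. \<exists>u\<in>carrier_vec m. f x u = y))"

definition hconcat_mat :: "real mat \<Rightarrow> real mat \<Rightarrow> real mat" where
  "hconcat_mat A B = mat (dim_row A) (dim_col A + dim_col B)
     (\<lambda>(i, j). if j < dim_col A then A $$ (i, j) else B $$ (i, j - dim_col A))"

definition mat_image :: "real mat \<Rightarrow> real vec set" where
  "mat_image M = (\<lambda>v. M *\<^sub>v v) ` carrier_vec (dim_col M)"


section \<open>Physical constants\<close>

text \<open>
  Suffixes \<open>_p\<close> and \<open>_s\<close> refer to the piezoelectric layer and the substrate; \<open>C_p\<close> is the
  stiffness \<open>C\<^sub>1\<^sub>1\<^sub>,\<^sub>p\<close>. The sign conditions on the constants are hypotheses of the theorem.
\<close>

record piezo =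
  rho_p :: real
  rho_s :: real
  C_p :: real
  C_s :: real
  beta :: real
  mu :: real
  gamma :: real
  g_b :: real
  h_a :: real
  h_b :: real
  A_s :: real
  I_s :: real

definition A_p :: "piezo \<Rightarrow> real" where
  "A_p P = 2 * g_b P * (h_b P - h_a P)"

definition I_p :: "piezo \<Rightarrow> real" where
  "I_p P = 2 / 3 * g_b P * (h_b P ^ 3 - h_a P ^ 3)"

definition I_0 :: "piezo \<Rightarrow> real" where
  "I_0 P = g_b P * (h_b P ^ 2 - h_a P ^ 2)"

definition rho_A :: "piezo \<Rightarrow> real" where
  "rho_A P = rho_p P * A_p P + rho_s P * A_s P"

definition rho_I :: "piezo \<Rightarrow> real" where
  "rho_I P = rho_p P * I_p P + rho_s P * I_s P"

definition rho_I0 :: "piezo \<Rightarrow> real" where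
  "rho_I0 P = rho_p P * I_0 P"

definition C_A :: "piezo \<Rightarrow> real" where
  "C_A P = C_p P * A_p P + C_s P * A_s P"

definition C_I :: "piezo \<Rightarrow> real" where
  "C_I P = C_p P * I_p P + C_s P * I_s P"

definition C_I0 :: "piezo \<Rightarrow> real" where
  "C_I0 P = C_p P * I_0 P"

definition Delta :: "piezo \<Rightarrow> real" where
  "Delta P = rho_A P * rho_I P - (rho_I0 P) ^ 2"


section \<open>The port-Hamiltonian system\<close>

definition Q1 :: "piezo \<Rightarrow> real mat" where
  "Q1 P = mat_of_rows_list 3
    [[C_A P + gamma P ^ 2 * beta P * A_p P, - (C_I0 P + gamma P ^ 2 * beta P * I_0 P), 0],
     [- (C_I0 P + gamma P ^ 2 * beta P * I_0 P),
        C_I P + gamma P ^ 2 * beta P * (I_0 P ^ 2 / A_p P), 0],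
     [0, 0, A_p P / mu P]]"

definition Q2 :: "piezo \<Rightarrow> real mat" where
  "Q2 P = mat_of_rows_list 3
    [[0, 0, - (gamma P * beta P)],
     [0, 0, gamma P * beta P * (I_0 P / A_p P)],
     [0, 0, 0]]"

definition Q4 :: "piezo \<Rightarrow> real mat" where
  "Q4 P = mat_of_rows_list 3
    [[rho_I P / Delta P, rho_I0 P / Delta P, 0],
     [rho_I0 P / Delta P, rho_A P / Delta P, 0],
     [0, 0, beta P / A_p P]]"

definition Qmat :: "piezo \<Rightarrow> real mat" where
  "Qmat P = four_block_mat (Q1 P) (Q2 P) (transpose_mat (Q2 P)) (Q4 P)"

definition Be :: "piezo \<Rightarrow> real vec" where
  "Be P = vec_of_list [0, 0, 0, 0, 0, - (h_b P - h_a P)]"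


section \<open>The mixed finite element system\<close>

definition mesh :: "nat \<Rightarrow> real \<Rightarrow> (nat \<Rightarrow> real) \<Rightarrow> bool" where
  "mesh N l z \<longleftrightarrow> z 0 = 0 \<and> z N = l \<and> (\<forall>j<N. z j < z (Suc j))"

text \<open>
  Segments are numbered \<open>1, \<dots>, N\<close>, segment \<open>j\<close> being \<open>[z (j - 1), z j]\<close>; nodes are numbered
  \<open>0, \<dots>, N\<close>. The global state is the concatenation of the segment states \<open>x\<^sub>1, \<dots>, x\<^sub>N\<close>.
\<close>

definition seg :: "real vec \<Rightarrow> nat \<Rightarrow> real vec" where
  "seg x j = vec 6 (\<lambda>i. x $ (6 * (j - 1) + i))"

definition seg_Qx :: "piezo \<Rightarrow> (nat \<Rightarrow> real) \<Rightarrow> real vec \<Rightarrow> nat \<Rightarrow> real vec" where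
  "seg_Qx P z x j = (1 / (z j - z (j - 1))) \<cdot>\<^sub>v (Qmat P *\<^sub>v seg x j)"

text \<open>The equations for the nodal flows \<open>f\<close> and efforts \<open>e\<close>.\<close>

definition nodal_values ::
  "piezo \<Rightarrow> nat \<Rightarrow> (nat \<Rightarrow> real) \<Rightarrow> real vec \<Rightarrow> (nat \<Rightarrow> real vec) \<Rightarrow> (nat \<Rightarrow> real vec) \<Rightarrow> bool" where
  "nodal_values P N z x f e \<longleftrightarrow>
     (\<forall>j\<le>N. f j \<in> carrier_vec 3 \<and> e j \<in> carrier_vec 3) \<and>
     f 0 = 0\<^sub>v 3 \<and> e N = 0\<^sub>v 3 \<and>
     (\<forall>j\<in>{1..N}.
        ((1 / 2) \<cdot>\<^sub>v (e (j - 1) + e j)) @\<^sub>v ((1 / 2) \<cdot>\<^sub>v (f (j - 1) + f j)) = seg_Qx P z x j)"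

text \<open>
  Their solution: the flows are obtained from the node 0 upwards and the efforts from the node
  \<open>N\<close> downwards; \<open>effort_down P N z x k\<close> is the effort at node \<open>N - k\<close>. The lemma
  \<open>nodal_values_iff\<close> below shows that this is the unique solution.
\<close>

primrec flow :: "piezo \<Rightarrow> (nat \<Rightarrow> real) \<Rightarrow> real vec \<Rightarrow> nat \<Rightarrow> real vec" where
  "flow P z x 0 = 0\<^sub>v 3"
| "flow P z x (Suc j) = 2 \<cdot>\<^sub>v vec_last (seg_Qx P z x (Suc j)) 3 - flow P z x j"

primrec effort_down :: "piezo \<Rightarrow> nat \<Rightarrow> (nat \<Rightarrow> real) \<Rightarrow> real vec \<Rightarrow> nat \<Rightarrow> real vec" where
  "effort_down P N z x 0 = 0\<^sub>v 3"
| "effort_down P N z x (Suc k) =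
     2 \<cdot>\<^sub>v vec_first (seg_Qx P z x (N - k)) 3 - effort_down P N z x k"

definition effort :: "piezo \<Rightarrow> nat \<Rightarrow> (nat \<Rightarrow> real) \<Rightarrow> real vec \<Rightarrow> nat \<Rightarrow> real vec" where
  "effort P N z x j = effort_down P N z x (N - j)"

text \<open>The part of \<open>x\<^sub>j'\<close> that does not involve the input.\<close>

definition seg_drift :: "piezo \<Rightarrow> nat \<Rightarrow> (nat \<Rightarrow> real) \<Rightarrow> real vec \<Rightarrow> nat \<Rightarrow> real vec" where
  "seg_drift P N z x j =
     (flow P z x j - flow P z x (j - 1)) @\<^sub>v (effort P N z x j - effort P N z x (j - 1))"

text \<open>
  The right-hand side is linear in the state (lemma \<open>mfem_A_mult_vec\<close>), so \<open>A\<^sub>N\<close> is its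
  matrix: column \<open>k\<close> is the value at the \<open>k\<close>-th unit vector. Row \<open>i\<close> is component \<open>i mod 6\<close> of
  segment \<open>i div 6 + 1\<close>.
\<close>

definition mfem_A :: "piezo \<Rightarrow> nat \<Rightarrow> (nat \<Rightarrow> real) \<Rightarrow> real mat" where
  "mfem_A P N z = mat (6 * N) (6 * N)
     (\<lambda>(i, k). seg_drift P N z (unit_vec (6 * N) k) (i div 6 + 1) $ (i mod 6))"

definition mfem_B :: "piezo \<Rightarrow> nat \<Rightarrow> real mat" where
  "mfem_B P N = mat (6 * N) 1 (\<lambda>(i, _). Be P $ (i mod 6))"


section \<open>Adequacy of the definitions\<close>

lemma Qmat_carrier: "Qmat P \<in> carrier_mat 6 6"
proof -
  have "Q1 P \<in> carrier_mat 3 3" "Q4 P \<in> carrier_mat 3 3"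
    by (auto simp: Q1_def Q4_def mat_of_rows_list_def)
  from four_block_carrier_mat[OF this] show ?thesis by (simp add: Qmat_def)
qed

lemma seg_Qx_carrier: "seg_Qx P z x j \<in> carrier_vec 6"
  using Qmat_carrier[of P] by (intro carrier_vecI) (simp add: seg_Qx_def)

lemma flow_carrier: "flow P z x j \<in> carrier_vec 3"
  by (induction j) auto

lemma effort_down_carrier: "effort_down P N z x k \<in> carrier_vec 3"
  by (induction k) auto

lemma effort_carrier: "effort P N z x j \<in> carrier_vec 3"
  by (simp add: effort_def effort_down_carrier)

lemma effort_pred:
  assumes "j \<in> {1..N}"
  shows "effort P N z x (j - 1) = 2 \<cdot>\<^sub>v vec_first (seg_Qx P z x j) 3 - effort P N z x j"
proof -
  have "N - (j - 1) = Suc (N - j)" "N - (N - j) = j" using assms by auto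
  then show ?thesis by (simp add: effort_def)
qed

lemma half_sum_iff:
  fixes a b c :: "real vec"
  assumes "a \<in> carrier_vec n" "b \<in> carrier_vec n" "c \<in> carrier_vec n"
  shows "(1 / 2) \<cdot>\<^sub>v (a + b) = c \<longleftrightarrow> b = 2 \<cdot>\<^sub>v c - a"
proof
  assume "(1 / 2) \<cdot>\<^sub>v (a + b) = c"
  then show "b = 2 \<cdot>\<^sub>v c - a" using assms by (intro eq_vecI) (auto simp: field_simps)
next
  assume "b = 2 \<cdot>\<^sub>v c - a"
  then show "(1 / 2) \<cdot>\<^sub>v (a + b) = c" using assms by (intro eq_vecI) auto
qed

lemma nodal_values_alt:
  assumes "\<And>j. j \<le> N \<Longrightarrow> f j \<in> carrier_vec 3" "\<And>j. j \<le> N \<Longrightarrow> e j \<in> carrier_vec 3"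
    and j: "j \<in> {1..N}"
  shows "((1 / 2) \<cdot>\<^sub>v (e (j - 1) + e j)) @\<^sub>v ((1 / 2) \<cdot>\<^sub>v (f (j - 1) + f j)) = seg_Qx P z x j
     \<longleftrightarrow> e (j - 1) = 2 \<cdot>\<^sub>v vec_first (seg_Qx P z x j) 3 - e j
       \<and> f j = 2 \<cdot>\<^sub>v vec_last (seg_Qx P z x j) 3 - f (j - 1)"
proof -
  have j': "j - 1 \<le> N" "j \<le> N" using j by auto
  have c: "f (j - 1) \<in> carrier_vec 3" "f j \<in> carrier_vec 3"
    "e (j - 1) \<in> carrier_vec 3" "e j \<in> carrier_vec 3"
    using assms(1,2) j' by blast+
  have "seg_Qx P z x j = vec_first (seg_Qx P z x j) 3 @\<^sub>v vec_last (seg_Qx P z x j) 3"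
    using seg_Qx_carrier[of P z x j] by (simp add: vec_first_last_append)
  then have "((1 / 2) \<cdot>\<^sub>v (e (j - 1) + e j)) @\<^sub>v ((1 / 2) \<cdot>\<^sub>v (f (j - 1) + f j)) = seg_Qx P z x j
     \<longleftrightarrow> (1 / 2) \<cdot>\<^sub>v (e j + e (j - 1)) = vec_first (seg_Qx P z x j) 3
       \<and> (1 / 2) \<cdot>\<^sub>v (f (j - 1) + f j) = vec_last (seg_Qx P z x j) 3"
    using c append_vec_eq[of "(1 / 2) \<cdot>\<^sub>v (e (j - 1) + e j)" 3 "vec_first (seg_Qx P z x j) 3"]
    by (metis add_carrier_vec comm_add_vec smult_carrier_vec vec_first_carrier)
  then show ?thesis using c by (simp add: half_sum_iff)
qed

lemma nodal_values_flow_effort: "nodal_values P N z x (flow P z x) (effort P N z x)"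
proof -
  have "flow P z x j = 2 \<cdot>\<^sub>v vec_last (seg_Qx P z x j) 3 - flow P z x (j - 1)"
    if "j \<in> {1..N}" for j
    using that by (cases j) auto
  moreover have "effort P N z x N = 0\<^sub>v 3" by (simp add: effort_def)
  ultimately show ?thesis
    unfolding nodal_values_def
    using nodal_values_alt[of N "flow P z x" "effort P N z x" _ P z x, OF flow_carrier effort_carrier]
      effort_pred[of _ N P z x]
    by (auto simp: flow_carrier effort_carrier simp del: One_nat_def)
qed

lemma nodal_values_iff:
  "nodal_values P N z x f e \<longleftrightarrow> (\<forall>j\<le>N. f j = flow P z x j \<and> e j = effort P N z x j)"
proof
  assume nv: "nodal_values P N z x f e"
  then have c: "f j \<in> carrier_vec 3" "e j \<in> carrier_vec 3" if "j \<le> N" for j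
    using that by (auto simp: nodal_values_def)
  have step: "e (j - 1) = 2 \<cdot>\<^sub>v vec_first (seg_Qx P z x j) 3 - e j
       \<and> f j = 2 \<cdot>\<^sub>v vec_last (seg_Qx P z x j) 3 - f (j - 1)" if "j \<in> {1..N}" for j
    using nodal_values_alt[of N f e j P z x] c that nv unfolding nodal_values_def by blast
  have f: "j \<le> N \<Longrightarrow> f j = flow P z x j" for j
  proof (induction j)
    case 0
    then show ?case using nv by (simp add: nodal_values_def)
  next
    case (Suc j)
    then show ?case using step[of "Suc j"] by simp
  qed
  have "k \<le> N \<Longrightarrow> e (N - k) = effort_down P N z x k" for k
  proof (induction k)
    case 0
    then show ?case using nv by (simp add: nodal_values_def)
  next
    case (Suc k)
    then show ?case using step[of "N - k"] by simp
  qed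
  then have "e j = effort P N z x j" if "j \<le> N" for j
    using that by (metis diff_diff_cancel diff_le_self effort_def)
  with f show "\<forall>j\<le>N. f j = flow P z x j \<and> e j = effort P N z x j" by blast
next
  assume eq: "\<forall>j\<le>N. f j = flow P z x j \<and> e j = effort P N z x j"
  have "f (j - 1) = flow P z x (j - 1) \<and> e (j - 1) = effort P N z x (j - 1)
      \<and> f j = flow P z x j \<and> e j = effort P N z x j" if "j \<in> {1..N}" for j
    using eq that by auto
  with eq nodal_values_flow_effort[of P N z x] show "nodal_values P N z x f e"
    unfolding nodal_values_def by (metis le0 order_refl)
qed

lemma seg_Qx_expand:
  assumes x: "x \<in> carrier_vec (6 * N)" and j: "j \<in> {1..N}" and c: "c < 6"
  shows "seg_Qx P z x j $ c = (\<Sum>k<6 * N. x $ k * seg_Qx P z (unit_vec (6 * N) k) j $ c)"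
proof -
  let ?h = "1 / (z j - z (j - 1))"
  have formula: "seg_Qx P z y j $ c = ?h * (\<Sum>d<6. Qmat P $$ (c, d) * y $ (6 * (j - 1) + d))" for y
    using c Qmat_carrier[of P]
    by (auto simp: seg_Qx_def seg_def scalar_prod_def atLeast0LessThan intro!: sum.cong)
  have pt: "x $ i = (\<Sum>k<6 * N. x $ k * unit_vec (6 * N) k $ i)" if "i < 6 * N" for i
  proof -
    have "(\<Sum>k<6 * N. x $ k * unit_vec (6 * N) k $ i) = (\<Sum>k<6 * N. if k = i then x $ k else 0)"
      using that by (intro sum.cong) auto
    then show ?thesis using that by simp
  qed
  have "seg_Qx P z x j $ c = ?h * (\<Sum>d<6. Qmat P $$ (c, d) *
      (\<Sum>k<6 * N. x $ k * unit_vec (6 * N) k $ (6 * (j - 1) + d)))"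
    unfolding formula
    by (intro arg_cong[where f = "\<lambda>s. ?h * s"] sum.cong refl, subst pt) (use j in auto)
  also have "\<dots> = (\<Sum>d<6. \<Sum>k<6 * N. x $ k *
      (?h * (Qmat P $$ (c, d) * unit_vec (6 * N) k $ (6 * (j - 1) + d))))"
    by (simp only: sum_distrib_left mult.left_commute)
  also have "\<dots> = (\<Sum>k<6 * N. \<Sum>d<6. x $ k *
      (?h * (Qmat P $$ (c, d) * unit_vec (6 * N) k $ (6 * (j - 1) + d))))"
    by (rule sum.swap)
  finally show ?thesis by (simp only: formula sum_distrib_left)
qed

lemma flow_expand:
  assumes x: "x \<in> carrier_vec (6 * N)" and "j \<le> N" and c: "c < 3"
  shows "flow P z x j $ c = (\<Sum>k<6 * N. x $ k * flow P z (unit_vec (6 * N) k) j $ c)"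
  using \<open>j \<le> N\<close>
proof (induction j)
  case 0
  then show ?case using c by simp
next
  case (Suc j)
  have fc: "dim_vec (flow P z y j) = 3" for y using flow_carrier[of P z y j] by simp
  have qc: "dim_vec (seg_Qx P z y i) = 6" for y i using seg_Qx_carrier[of P z y i] by simp
  have step: "flow P z y (Suc j) $ c = 2 * seg_Qx P z y (Suc j) $ (3 + c) - flow P z y j $ c" for y
    using c by (simp add: fc qc vec_last_def)
  show ?case
    unfolding step
    using Suc c seg_Qx_expand[OF x, of "Suc j" "3 + c" P z]
    by (simp add: algebra_simps sum_subtractf sum_distrib_left)
qed

lemma effort_down_expand:
  assumes x: "x \<in> carrier_vec (6 * N)" and "i \<le> N" and c: "c < 3"
  shows "effort_down P N z x i $ c
    = (\<Sum>k<6 * N. x $ k * effort_down P N z (unit_vec (6 * N) k) i $ c)"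
  using \<open>i \<le> N\<close>
proof (induction i)
  case 0
  then show ?case using c by simp
next
  case (Suc i)
  have ec: "dim_vec (effort_down P N z y i) = 3" for y
    using effort_down_carrier[of P N z y i] by simp
  have step: "effort_down P N z y (Suc i) $ c
      = 2 * seg_Qx P z y (N - i) $ c - effort_down P N z y i $ c" for y
    using c by (simp add: ec vec_first_def)
  show ?case
    unfolding step
    using Suc c seg_Qx_expand[OF x, of "N - i" c P z]
    by (simp add: algebra_simps sum_subtractf sum_distrib_left)
qed

lemma seg_drift_carrier: "seg_drift P N z x j \<in> carrier_vec 6"
proof -
  have "dim_vec (seg_drift P N z x j) = 6"
    using flow_carrier[of P z x "j - 1"] effort_carrier[of P N z x "j - 1"]
    by (simp add: seg_drift_def)
  then show ?thesis by (rule carrier_vecI)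
qed

lemma seg_drift_expand:
  assumes x: "x \<in> carrier_vec (6 * N)" and j: "j \<in> {1..N}" and c: "c < 6"
  shows "seg_drift P N z x j $ c = (\<Sum>k<6 * N. x $ k * seg_drift P N z (unit_vec (6 * N) k) j $ c)"
proof -
  have d: "dim_vec (flow P z y i) = 3" "dim_vec (effort P N z y i) = 3" for y i
    using flow_carrier[of P z y i] effort_carrier[of P N z y i] by auto
  have formula: "seg_drift P N z y j $ c =
      (if c < 3 then flow P z y j $ c - flow P z y (j - 1) $ c
       else effort P N z y j $ (c - 3) - effort P N z y (j - 1) $ (c - 3))" for y
    using c by (auto simp: seg_drift_def d)
  have j': "j \<le> N" "j - 1 \<le> N" using j by auto
  show ?thesis
  proof (cases "c < 3")
    case True
    show ?thesis
      unfolding formula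
      using True flow_expand[OF x j'(1) True, of P z] flow_expand[OF x j'(2) True, of P z]
      by (simp add: right_diff_distrib sum_subtractf)
  next
    case False
    then have c3: "c - 3 < 3" using c by simp
    show ?thesis
      unfolding formula effort_def
      using False effort_down_expand[OF x diff_le_self c3, of P z j]
        effort_down_expand[OF x diff_le_self c3, of P z "j - 1"]
      by (simp add: right_diff_distrib sum_subtractf)
  qed
qed

lemma mfem_A_mult_vec:
  assumes x: "x \<in> carrier_vec (6 * N)" and nv: "nodal_values P N z x f e" and j: "j \<in> {1..N}"
  shows "seg (mfem_A P N z *\<^sub>v x) j = (f j - f (j - 1)) @\<^sub>v (e j - e (j - 1))"
proof -
  have "j \<le> N" "j - 1 \<le> N" using j by auto
  with nv have rhs: "(f j - f (j - 1)) @\<^sub>v (e j - e (j - 1)) = seg_drift P N z x j"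
    by (simp add: nodal_values_iff seg_drift_def)
  have "seg (mfem_A P N z *\<^sub>v x) j = seg_drift P N z x j"
  proof (rule eq_vecI)
    show "dim_vec (seg (mfem_A P N z *\<^sub>v x) j) = dim_vec (seg_drift P N z x j)"
      using seg_drift_carrier[of P N z x j] by (simp add: seg_def)
  next
    fix c assume "c < dim_vec (seg_drift P N z x j)"
    then have c: "c < 6" using seg_drift_carrier[of P N z x j] by simp
    have i: "6 * (j - 1) + c < 6 * N" using j c by auto
    have dm: "(6 * (j - 1) + c) div 6 + 1 = j" "(6 * (j - 1) + c) mod 6 = c" using j c by auto
    have "seg (mfem_A P N z *\<^sub>v x) j $ c
        = (\<Sum>k<6 * N. mfem_A P N z $$ (6 * (j - 1) + c, k) * x $ k)"
      using c i x by (simp add: seg_def mfem_A_def scalar_prod_def atLeast0LessThan)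
    also have "\<dots> = (\<Sum>k<6 * N. x $ k * seg_drift P N z (unit_vec (6 * N) k) j $ c)"
    proof (rule sum.cong[OF refl])
      fix k assume "k \<in> {..<6 * N}"
      then have "mfem_A P N z $$ (6 * (j - 1) + c, k)
          = seg_drift P N z (unit_vec (6 * N) k) j $ c"
        using i unfolding mfem_A_def by (simp only: index_mat lessThan_iff prod.case dm)
      then show "mfem_A P N z $$ (6 * (j - 1) + c, k) * x $ k
          = x $ k * seg_drift P N z (unit_vec (6 * N) k) j $ c" by simp
    qed
    finally show "seg (mfem_A P N z *\<^sub>v x) j $ c = seg_drift P N z x j $ c"
      using seg_drift_expand[OF x j c] by simp
  qed
  with rhs show ?thesis by simp
qed

end

theory Submission
  imports Defs
begin

text \<open>
  The drift matrix \<open>A\<^sub>N\<close> alone is surjective, and both claims follow with input \<open>u = 0\<close>. Let \<open>y\<close>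
  be a target with segments \<open>(a\<^sub>j, b\<^sub>j)\<close>. The dynamics only see the increments of the nodal
  flows and efforts, and the boundary conditions \<open>f\<^sub>0 = 0\<close>, \<open>e\<^sub>N = 0\<close> leave exactly one way to
  realise given increments: \<open>f\<^sub>j\<close> is the sum of the \<open>a\<^sub>i\<close> with \<open>i \<le> j\<close>, and \<open>e\<^sub>j\<close> is minus the
  sum of the \<open>b\<^sub>i\<close> with \<open>i > j\<close>. The nodal equations then prescribe the vector
  \<open>Q x\<^sub>j\<close> on every segment separately, with no coupling left between segments, so it only remains
  to solve \<open>Q x = r\<close> for arbitrary \<open>r\<close> (lemma \<open>Qmat_surj\<close>).

  The matrix \<open>Q\<close> is invertible because the electric momentum can be eliminated by means of the last
  row: all terms in \<open>\<gamma>\<close> cancel, and the third row being decoupled, what remains is the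
  purely mechanical problem, consisting of the stiffness block with determinant \<open>C\<^sub>A C\<^sub>I - C\<^sub>I\<^sub>0\<^sup>2\<close>
  and the inverse of the mass block with determinant \<open>\<Delta>\<close>. Both determinants are instances of the same expression in two
  positive weights for the layers, and they are positive by the Cauchy--Schwarz inequality
  \<open>I\<^sub>0\<^sup>2 < A\<^sub>p I\<^sub>p\<close> for the moments of the cross-section of the piezoelectric layer
  (lemma \<open>moment_cauchy_schwarz\<close>).
\<close>


section \<open>Solvability of the constitutive equations\<close>

lemma A_p_pos:
  assumes "g_b P > 0" "h_a P < h_b P"
  shows "A_p P > 0"
  using assms by (simp add: A_p_def)

text \<open>
  The constants \<open>A\<^sub>p\<close>, \<open>I\<^sub>0\<close>, \<open>I\<^sub>p\<close> are \<open>2 g\<^sub>b\<close> times the moments of order 0, 1, 2 of the height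
  over \<open>[h\<^sub>a, h\<^sub>b]\<close>; the defect in the inequality is explicit, namely
  \<open>g\<^sub>b\<^sup>2 (h\<^sub>b - h\<^sub>a)\<^sup>4 / 3\<close>.
\<close>

lemma moment_cauchy_schwarz:
  assumes "g_b P > 0" "h_a P < h_b P"
  shows "I_0 P ^ 2 < A_p P * I_p P"
proof -
  have "A_p P * I_p P - I_0 P ^ 2 = g_b P ^ 2 * (h_b P - h_a P) ^ 4 / 3"
    by (simp add: A_p_def I_p_def I_0_def field_simps power2_eq_square power3_eq_cube
        power4_eq_xxxx)
  moreover have "g_b P ^ 2 * (h_b P - h_a P) ^ 4 / 3 > 0"
    using assms by simp
  ultimately show ?thesis by simp
qed

text \<open>
  The common form of the determinants of the mass block and of the stiffness block, where \<open>c\<close> and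
  \<open>d\<close> are the densities, respectively the stiffnesses, of the two layers. Adding the substrate can
  only increase the determinant of the piezoelectric layer alone.
\<close>

lemma composite_determinant_pos:
  assumes "g_b P > 0" "h_a P < h_b P" "A_s P > 0" "I_s P > 0" "c > 0" "d > 0"
  shows "(c * A_p P + d * A_s P) * (c * I_p P + d * I_s P) - (c * I_0 P) ^ 2 > 0"
proof -
  have A: "A_p P > 0" and cs: "I_0 P ^ 2 < A_p P * I_p P"
    using A_p_pos moment_cauchy_schwarz assms by auto
  have "A_p P * I_p P > 0"
    using cs by (rule le_less_trans[OF zero_le_power2])
  then have I: "I_p P > 0" using A by (simp add: zero_less_mult_iff)
  have "(c * A_p P + d * A_s P) * (c * I_p P + d * I_s P) - (c * I_0 P) ^ 2
      = c ^ 2 * (A_p P * I_p P - I_0 P ^ 2)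
        + c * d * (A_p P * I_s P + A_s P * I_p P) + d ^ 2 * (A_s P * I_s P)"
    by (simp add: field_simps power2_eq_square)
  moreover have "c ^ 2 * (A_p P * I_p P - I_0 P ^ 2) > 0"
    using cs assms by simp
  moreover have "c * d * (A_p P * I_s P + A_s P * I_p P) > 0" "d ^ 2 * (A_s P * I_s P) > 0"
    using A I assms by (auto intro!: mult_pos_pos add_pos_pos)
  ultimately show ?thesis by linarith
qed

lemma Qmat_mult_vec:
  "Qmat P *\<^sub>v vec_of_list [q1, q2, q3, p1, p2, p3] = vec_of_list
    [(C_A P + gamma P ^ 2 * beta P * A_p P) * q1
       - (C_I0 P + gamma P ^ 2 * beta P * I_0 P) * q2 - gamma P * beta P * p3,
     - (C_I0 P + gamma P ^ 2 * beta P * I_0 P) * q1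
       + (C_I P + gamma P ^ 2 * beta P * (I_0 P ^ 2 / A_p P)) * q2
       + gamma P * beta P * (I_0 P / A_p P) * p3,
     A_p P / mu P * q3,
     rho_I P / Delta P * p1 + rho_I0 P / Delta P * p2,
     rho_I0 P / Delta P * p1 + rho_A P / Delta P * p2,
     - (gamma P * beta P) * q1 + gamma P * beta P * (I_0 P / A_p P) * q2 + beta P / A_p P * p3]"
    (is "?Q *\<^sub>v ?x = ?r")
proof (rule eq_vecI)
  show "dim_vec (?Q *\<^sub>v ?x) = dim_vec ?r"
    using Qmat_carrier[of P] by simp
next
  fix i assume "i < dim_vec ?r"
  then have i: "i \<in> {0, 1, 2, 3, 4, 5}" by auto
  have "(?Q *\<^sub>v x) $ i = (\<Sum>k<6. ?Q $$ (i, k) * x $ k)" if "dim_vec x = 6" for x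
    using i that Qmat_carrier[of P]
    by (auto simp: scalar_prod_def atLeast0LessThan intro!: sum.cong)
  then have "(?Q *\<^sub>v ?x) $ i = (\<Sum>k<6. ?Q $$ (i, k) * ?x $ k)" by simp
  moreover have sum6: "(\<Sum>k<6. g k) = g 0 + g 1 + g 2 + g 3 + g 4 + g 5" for g :: "nat \<Rightarrow> real"
    by (simp add: eval_nat_numeral)
  have "(\<Sum>k<6. ?Q $$ (i, k) * ?x $ k) = ?r $ i"
    using i by (elim insertE) (simp_all add: sum6 vec_of_list_index Qmat_def Q1_def Q2_def Q4_def
        mat_of_rows_list_def algebra_simps del: vec_of_list_Cons vec_of_list_Nil)
  ultimately show "(?Q *\<^sub>v ?x) $ i = ?r $ i" by simp
qed

lemma symmetric_2x2_solvable:
  fixes a b c r s :: real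
  assumes "a * c - b ^ 2 \<noteq> 0"
  obtains x y where "a * x - b * y = r" "c * y - b * x = s"
proof -
  let ?D = "a * c - b ^ 2"
  let ?x = "(c * r + b * s) / ?D" and ?y = "(b * r + a * s) / ?D"
  have "a * ?x - b * ?y = r * ?D / ?D"
    by (simp only: times_divide_eq_right diff_divide_distrib[symmetric])
      (simp add: algebra_simps power2_eq_square)
  moreover have "c * ?y - b * ?x = s * ?D / ?D"
    by (simp only: times_divide_eq_right diff_divide_distrib[symmetric])
      (simp add: algebra_simps power2_eq_square)
  ultimately show ?thesis
    using assms that[of ?x ?y] by (simp only: nonzero_mult_div_cancel_right[OF assms])
qed

lemma Qmat_surj:
  assumes pos: "rho_p P > 0" "rho_s P > 0" "C_p P > 0" "C_s P > 0" "beta P > 0" "mu P > 0"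
      "g_b P > 0" "h_a P < h_b P" "A_s P > 0" "I_s P > 0"
    and r: "r \<in> carrier_vec 6"
  obtains x where "x \<in> carrier_vec 6" "Qmat P *\<^sub>v x = r"
proof -
  have A: "A_p P \<noteq> 0" using A_p_pos pos by (metis less_irrefl)
  have D: "Delta P \<noteq> 0"
    using composite_determinant_pos[of P "rho_p P" "rho_s P"] pos
    by (simp add: Delta_def rho_A_def rho_I_def rho_I0_def)
  have E: "C_A P * C_I P - C_I0 P ^ 2 \<noteq> 0"
    using composite_determinant_pos[of P "C_p P" "C_s P"] pos
    by (simp add: C_A_def C_I_def C_I0_def)
  \<comment> \<open>The right-hand sides arise from rows 1 and 2 on adding multiples of row 6 that remove the
    electric momentum.\<close>
  obtain q1 q2 where
    q1: "C_A P * q1 - C_I0 P * q2 = r $ 0 + gamma P * A_p P * r $ 5" and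
    q2: "C_I P * q2 - C_I0 P * q1 = r $ 1 - gamma P * I_0 P * r $ 5"
    using symmetric_2x2_solvable[OF E] by blast
  define q3 where "q3 = mu P / A_p P * r $ 2"
  \<comment> \<open>The upper left part of \<open>Q\<^sub>4\<close> is the inverse of the mass block.\<close>
  define p1 where "p1 = rho_A P * r $ 3 - rho_I0 P * r $ 4"
  define p2 where "p2 = rho_I P * r $ 4 - rho_I0 P * r $ 3"
  define p3 where "p3 = A_p P / beta P * r $ 5 + gamma P * A_p P * q1 - gamma P * I_0 P * q2"
  have bp3: "beta P * p3
      = A_p P * r $ 5 + beta P * (gamma P * A_p P * q1 - gamma P * I_0 P * q2)"
    using pos by (simp add: p3_def field_simps)
  have "(C_A P + gamma P ^ 2 * beta P * A_p P) * q1
       - (C_I0 P + gamma P ^ 2 * beta P * I_0 P) * q2 - gamma P * (beta P * p3) = r $ 0"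
    unfolding bp3 using q1 by (simp add: algebra_simps power2_eq_square)
  moreover have "- (C_I0 P + gamma P ^ 2 * beta P * I_0 P) * q1
       + (C_I P + gamma P ^ 2 * beta P * (I_0 P ^ 2 / A_p P)) * q2
       + gamma P * (I_0 P / A_p P) * (beta P * p3) = r $ 1"
    unfolding bp3 using q2 A
    by (simp add: algebra_simps power2_eq_square add_divide_distrib diff_divide_distrib)
  moreover have "A_p P / mu P * q3 = r $ 2"
    using A pos by (simp add: q3_def)
  moreover have "rho_I P / Delta P * p1 + rho_I0 P / Delta P * p2 = r $ 3"
  proof -
    have "rho_I P / Delta P * p1 + rho_I0 P / Delta P * p2 = Delta P * r $ 3 / Delta P"
      by (simp only: times_divide_eq_left add_divide_distrib[symmetric])
        (simp add: p1_def p2_def Delta_def algebra_simps power2_eq_square)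
    then show ?thesis using D by simp
  qed
  moreover have "rho_I0 P / Delta P * p1 + rho_A P / Delta P * p2 = r $ 4"
  proof -
    have "rho_I0 P / Delta P * p1 + rho_A P / Delta P * p2 = Delta P * r $ 4 / Delta P"
      by (simp only: times_divide_eq_left add_divide_distrib[symmetric])
        (simp add: p1_def p2_def Delta_def algebra_simps power2_eq_square)
    then show ?thesis using D by simp
  qed
  moreover have "- (gamma P * beta P) * q1 + gamma P * beta P * (I_0 P / A_p P) * q2
      + (beta P * p3) / A_p P = r $ 5"
    unfolding bp3 using A by (simp add: field_simps)
  ultimately have "Qmat P *\<^sub>v vec_of_list [q1, q2, q3, p1, p2, p3]
      = vec_of_list [r $ 0, r $ 1, r $ 2, r $ 3, r $ 4, r $ 5]"
    unfolding Qmat_mult_vec by (simp add: mult_ac)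
  also have "\<dots> = r"
  proof (rule eq_vecI)
    fix i assume "i < dim_vec r"
    then have "i \<in> {0, 1, 2, 3, 4, 5}" using r by auto
    then show "vec_of_list [r $ 0, r $ 1, r $ 2, r $ 3, r $ 4, r $ 5] $ i = r $ i"
      by (auto simp: eval_nat_numeral)
  qed (use r in simp)
  finally show ?thesis
    by (intro that[of "vec_of_list [q1, q2, q3, p1, p2, p3]"]) (auto intro: carrier_vecI)
qed


section \<open>Global vectors and their segments\<close>

lemma seg_concat:
  assumes "\<And>j. j \<in> {1..N} \<Longrightarrow> X j \<in> carrier_vec 6" and "j \<in> {1..N}"
  shows "seg (vec (6 * N) (\<lambda>i. X (i div 6 + 1) $ (i mod 6))) j = X j"
proof (rule eq_vecI)
  show "dim_vec (seg (vec (6 * N) (\<lambda>i. X (i div 6 + 1) $ (i mod 6))) j) = dim_vec (X j)"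
    using assms by (simp add: seg_def carrier_vecD[OF assms(1)])
next
  fix i assume "i < dim_vec (X j)"
  then have i: "i < 6" using assms carrier_vecD by metis
  have "6 * (j - 1) + i < 6 * N" "(6 * (j - 1) + i) div 6 + 1 = j" "(6 * (j - 1) + i) mod 6 = i"
    using i assms(2) by auto
  then show "seg (vec (6 * N) (\<lambda>i. X (i div 6 + 1) $ (i mod 6))) j $ i = X j $ i"
    using i unfolding seg_def by (simp only: index_vec)
qed

lemma eq_vec_segI:
  assumes x: "x \<in> carrier_vec (6 * N)" and y: "y \<in> carrier_vec (6 * N)"
    and eq: "\<And>j. j \<in> {1..N} \<Longrightarrow> seg x j = seg y j"
  shows "x = y"
proof (rule eq_vecI)
  fix i assume "i < dim_vec y"
  then have "i div 6 + 1 \<in> {1..N}" using y by auto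
  then have "seg x (i div 6 + 1) $ (i mod 6) = seg y (i div 6 + 1) $ (i mod 6)"
    by (simp only: eq)
  then show "x $ i = y $ i" by (simp add: seg_def)
qed (use x y in simp)


section \<open>Surjectivity of the drift and Brockett's condition\<close>

text \<open>
  The two cumulative sums are the discrete integration of the target from the clamped end and from
  the free end; everything else is local to one segment.
\<close>

lemma mfem_A_surj:
  assumes Q: "\<And>r. r \<in> carrier_vec 6 \<Longrightarrow> \<exists>x\<in>carrier_vec 6. Qmat P *\<^sub>v x = r"
    and z: "\<And>j. j < N \<Longrightarrow> z j < z (Suc j)" and y: "y \<in> carrier_vec (6 * N)"
  obtains x where "x \<in> carrier_vec (6 * N)" "mfem_A P N z *\<^sub>v x = y"
proof -
  define f where "f j = vec 3 (\<lambda>c. \<Sum>i\<in>{1..j}. seg y i $ c)" for j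
  define e where "e j = vec 3 (\<lambda>c. - (\<Sum>i\<in>{Suc j..N}. seg y i $ (3 + c)))" for j
  define r where "r j = ((1 / 2) \<cdot>\<^sub>v (e (j - 1) + e j)) @\<^sub>v ((1 / 2) \<cdot>\<^sub>v (f (j - 1) + f j))" for j
  have f: "f j \<in> carrier_vec 3" and e: "e j \<in> carrier_vec 3" for j
    by (simp_all add: f_def e_def)
  have r: "r j \<in> carrier_vec 6" for j
    using f[of j] e[of j] f[of "j - 1"] e[of "j - 1"] by (auto simp: r_def intro: carrier_vecI)
  have "\<forall>j. \<exists>x\<in>carrier_vec 6. Qmat P *\<^sub>v x = (z j - z (j - 1)) \<cdot>\<^sub>v r j"
    using Q r by simp
  then obtain X where X: "X j \<in> carrier_vec 6"
    and QX: "Qmat P *\<^sub>v X j = (z j - z (j - 1)) \<cdot>\<^sub>v r j" for j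
    by metis
  define x where "x = vec (6 * N) (\<lambda>i. X (i div 6 + 1) $ (i mod 6))"
  have x: "x \<in> carrier_vec (6 * N)" by (simp add: x_def)
  have seg_x: "seg x j = X j" if "j \<in> {1..N}" for j
    unfolding x_def using X that by (rule seg_concat)
  have "seg_Qx P z x j = r j" if "j \<in> {1..N}" for j
  proof -
    have "z (j - 1) < z j" using z[of "j - 1"] that by (cases j) auto
    then show ?thesis
      using r by (simp add: seg_Qx_def seg_x[OF that] QX smult_smult_assoc)
  qed
  moreover have "f 0 = 0\<^sub>v 3" "e N = 0\<^sub>v 3" by (auto simp: f_def e_def)
  ultimately have nv: "nodal_values P N z x f e"
    using f e by (simp add: nodal_values_def r_def)
  have A: "mfem_A P N z *\<^sub>v x \<in> carrier_vec (6 * N)"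
    by (intro carrier_vecI) (simp add: mfem_A_def)
  have "mfem_A P N z *\<^sub>v x = y"
  proof (rule eq_vec_segI[OF A y])
    fix j assume j: "j \<in> {1..N}"
    then obtain k where k: "j = Suc k" and kN: "k < N" by (cases j) auto
    have "(f j - f (j - 1)) @\<^sub>v (e j - e (j - 1)) = seg y j"
    proof (rule eq_vecI)
      show "dim_vec ((f j - f (j - 1)) @\<^sub>v (e j - e (j - 1))) = dim_vec (seg y j)"
        by (simp add: f_def e_def seg_def)
    next
      fix c assume "c < dim_vec (seg y j)"
      then have c: "c < 6" by (simp add: seg_def)
      have "{Suc k..N} = insert (Suc k) {Suc (Suc k)..N}" using kN by auto
      then have "(\<Sum>i\<in>{Suc k..N}. g i) = g (Suc k) + (\<Sum>i\<in>{Suc (Suc k)..N}. g i)"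
        for g :: "nat \<Rightarrow> real" by simp
      then show "((f j - f (j - 1)) @\<^sub>v (e j - e (j - 1))) $ c = seg y j $ c"
        using c by (simp add: k f_def e_def)
    qed
    then show "seg (mfem_A P N z *\<^sub>v x) j = seg y j"
      using mfem_A_mult_vec[OF x nv j] by simp
  qed
  with x show ?thesis by (rule that)
qed

lemma hconcat_mat_mult_append:
  assumes A: "A \<in> carrier_mat n k" and B: "B \<in> carrier_mat n m"
    and x: "x \<in> carrier_vec k" and u: "u \<in> carrier_vec m"
  shows "hconcat_mat A B *\<^sub>v (x @\<^sub>v u) = A *\<^sub>v x + B *\<^sub>v u"
proof (rule eq_vecI)
  fix i assume "i < dim_vec (A *\<^sub>v x + B *\<^sub>v u)"
  then have i: "i < n" using B by simp
  then have "row (hconcat_mat A B) i = row A i @\<^sub>v row B i"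
    using A B by (intro eq_vecI) (auto simp: hconcat_mat_def)
  then show "(hconcat_mat A B *\<^sub>v (x @\<^sub>v u)) $ i = (A *\<^sub>v x + B *\<^sub>v u) $ i"
    using i A B x u scalar_prod_append[of "row A i" k "row B i" m x u]
    by (simp add: hconcat_mat_def)
qed (use A B in \<open>simp add: hconcat_mat_def\<close>)

theorem theorem5:
  fixes P :: piezo and N :: nat and l :: real and z :: "nat \<Rightarrow> real"
  assumes "rho_p P > 0" and "rho_s P > 0"
    and "C_p P > 0" and "C_s P > 0"
    and "beta P > 0" and "mu P > 0"
    and "g_b P > 0" and "h_a P < h_b P"
    and "A_s P > 0" and "I_s P > 0"
    and "l > 0" and "N \<ge> 1" and "mesh N l z"
  shows "brockett_condition (6 * N) 1
           (\<lambda>x u. mfem_A P N z *\<^sub>v x + mfem_B P N *\<^sub>v u)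
       \<and> mat_image (hconcat_mat (mfem_A P N z) (mfem_B P N)) = carrier_vec (6 * N)"
proof -
  have A: "mfem_A P N z \<in> carrier_mat (6 * N) (6 * N)"
    and B: "mfem_B P N \<in> carrier_mat (6 * N) 1"
    by (simp_all add: mfem_A_def mfem_B_def)
  have Q: "\<exists>x\<in>carrier_vec 6. Qmat P *\<^sub>v x = r" if "r \<in> carrier_vec 6" for r
    using Qmat_surj[OF assms(1-10) that] by metis
  have z: "z j < z (Suc j)" if "j < N" for j
    using assms(13) that by (simp add: mesh_def)
  have surj: "\<exists>x\<in>carrier_vec (6 * N). mfem_A P N z *\<^sub>v x + mfem_B P N *\<^sub>v 0\<^sub>v 1 = y"
    if y: "y \<in> carrier_vec (6 * N)" for y
  proof -
    obtain x where "x \<in> carrier_vec (6 * N)" "mfem_A P N z *\<^sub>v x = y"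
      using mfem_A_surj[of P N z y] Q z y by blast
    moreover have "mfem_B P N *\<^sub>v 0\<^sub>v 1 = 0\<^sub>v (6 * N)"
      using B by (intro eq_vecI) auto
    ultimately show ?thesis using y by (intro bexI[of _ x]) auto
  qed
  have "brockett_condition (6 * N) 1 (\<lambda>x u. mfem_A P N z *\<^sub>v x + mfem_B P N *\<^sub>v u)"
    unfolding brockett_condition_def
  proof (intro exI[of _ 1] conjI ballI impI)
    fix y :: "real vec" assume "y \<in> carrier_vec (6 * N)"
    then show "\<exists>x\<in>carrier_vec (6 * N). \<exists>u\<in>carrier_vec 1.
        mfem_A P N z *\<^sub>v x + mfem_B P N *\<^sub>v u = y"
      using surj[of y] zero_carrier_vec[of 1] by meson
  qed simp
  moreover have "mat_image (hconcat_mat (mfem_A P N z) (mfem_B P N)) = carrier_vec (6 * N)"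
  proof
    show "mat_image (hconcat_mat (mfem_A P N z) (mfem_B P N)) \<subseteq> carrier_vec (6 * N)"
      using A by (auto simp: mat_image_def hconcat_mat_def intro!: carrier_vecI)
  next
    show "carrier_vec (6 * N) \<subseteq> mat_image (hconcat_mat (mfem_A P N z) (mfem_B P N))"
    proof
      fix y :: "real vec" assume "y \<in> carrier_vec (6 * N)"
      then obtain x where x: "x \<in> carrier_vec (6 * N)"
        and y: "mfem_A P N z *\<^sub>v x + mfem_B P N *\<^sub>v 0\<^sub>v 1 = y"
        using surj by blast
      have "x @\<^sub>v 0\<^sub>v 1 \<in> carrier_vec (dim_col (hconcat_mat (mfem_A P N z) (mfem_B P N)))"
        using A B x by (auto simp: hconcat_mat_def intro!: carrier_vecI)
      then show "y \<in> mat_image (hconcat_mat (mfem_A P N z) (mfem_B P N))"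
        unfolding mat_image_def
        using hconcat_mat_mult_append[OF A B x zero_carrier_vec] y by (metis image_eqI)
    qed
  qed
  ultimately show ?thesis ..
qed

end
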